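(* Let $n\ge 4$. Then $w_1=n$ and $W_1=\{\mathbf{a}_1,\mathbf{a}_2,\mathbf{a}_3\}$, where $\mathbf{a}_1=\overline{1}[n]$ (the all-ones sequence), $\mathbf{a}_2=1\cdot\overline{0}[n-1]$ and $\mathbf{a}_3=\overline{0}[n-1]\cdot 1$.
   Context: For $\mathbf{x}=(x_0,\ldots,x_{n-1})\in\mathbb{F}_2^n$, the derivative is $\partial\mathbf{x}=(x_0+x_1,x_1+x_2,\ldots,x_{n-2}+x_{n-1})\in\mathbb{F}_2^{n-1}$, with $\partial^0\mathbf{x}=\mathbf{x}$ and $\partial^i\mathbf{x}=\partial(\partial^{i-1}\mathbf{x})$. The Steinhaus triangle of $\mathbf{x}$ is $T(\mathbf{x})=(\mathbf{x},\partial\mathbf{x},\ldots,\partial^{n-1}\mathbf{x})$. The weight $|\mathbf{y}|$ of a binary sequence is its number of ones, and $|T(\mathbf{x})|=\sum_{i=0}^{n-1}|\partial^i\mathbf{x}|$. For fixed $n$, let $0=w_0<w_1<\cdots<w_m$ be all the distinct values of $|T(\mathbf{x})|$ for $\mathbf{x}\in\mathbb{F}_2^n$, and let $W_i=\{\mathbf{x}\in\mathbb{F}_2^n:|T(\mathbf{x})|=w_i\}$. Sequences are written as words; a dot denotes concatenation; $\overline{x_1\cdots x_p}[k]$ denotes the word formed by the first $k$ letters of the infinite periodic word $x_1\cdots x_px_1\cdots x_p\cdots$. *)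

theory Defs
  imports "HOL-Library.Z2"
begin

text \<open>Binary sequences are lists over the two-element field \<^typ>\<open>bit\<close>;
  words are indexed from 0, as are list positions.\<close>

definition binary_seqs :: "nat \<Rightarrow> bit list set" where
  "binary_seqs n = {x. length x = n}"

text \<open>\<^const>\<open>zip\<close> truncates to the shorter argument, so the derivative of a sequence
  of length \<open>n \<ge> 1\<close> has length \<open>n - 1\<close>.\<close>

definition deriv_seq :: "bit list \<Rightarrow> bit list" where
  "deriv_seq x = map2 (+) x (tl x)"

definition steinhaus_triangle :: "bit list \<Rightarrow> bit list list" where
  "steinhaus_triangle x = map (\<lambda>i. (deriv_seq ^^ i) x) [0..<length x]"

definition weight :: "bit list \<Rightarrow> nat" where
  "weight y = count_list y 1"

definition triangle_weight :: "bit list \<Rightarrow> nat" where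
  "triangle_weight x = (\<Sum>y\<leftarrow>steinhaus_triangle x. weight y)"

definition triangle_weights :: "nat \<Rightarrow> nat set" where
  "triangle_weights n = triangle_weight ` binary_seqs n"

text \<open>The values \<open>w\<^sub>0 < \<dots> < w\<^sub>m\<close>; only indices \<open>i \<le> m\<close>, that is
  \<open>i < card (triangle_weights n)\<close>, are meaningful.\<close>

definition w :: "nat \<Rightarrow> nat \<Rightarrow> nat" where
  "w n i = sorted_list_of_set (triangle_weights n) ! i"

definition W :: "nat \<Rightarrow> nat \<Rightarrow> bit list set" where
  "W n i = {x \<in> binary_seqs n. triangle_weight x = w n i}"

text \<open>The first \<open>k\<close> letters of the infinite periodic word with period \<open>p \<noteq> []\<close>.\<close>

definition periodic_prefix :: "'a list \<Rightarrow> nat \<Rightarrow> 'a list" where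
  "periodic_prefix p k = map (\<lambda>i. p ! (i mod length p)) [0..<k]"

lemma finite_triangle_weights: "finite (triangle_weights n)"
proof -
  have "finite (UNIV :: bit set)"
    by (rule finite_subset[of _ "{0, 1}"]) auto
  then have "finite {x :: bit list. set x \<subseteq> UNIV \<and> length x = n}"
    by (rule finite_lists_length_eq)
  then show ?thesis
    by (simp add: triangle_weights_def binary_seqs_def)
qed

end

theory Submission
  imports Defs
begin

text \<open>The rows give \<open>|T(x)| = |x| + |T(\<partial>x)|\<close>. If \<open>\<partial>x\<close> is zero and \<open>x\<close> is not, then \<open>x\<close> is constant
  with weight \<open>n\<close>; otherwise \<open>|x| \<ge> 1\<close> and induction gives \<open>|T(x)| \<ge> n\<close>, where equality forces
  \<open>|x| = 1\<close> and \<open>\<partial>x\<close> to be minimal. For \<open>n \<ge> 5\<close> the only sequences of weight one whose derivative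
  is one of the three minimal sequences of length \<open>n - 1\<close> are \<open>10\<dots>0\<close> and \<open>0\<dots>01\<close>;
  the case \<open>n = 4\<close> is checked directly.\<close>

lemma deriv_seq_simps [simp]:
  "deriv_seq [] = []"
  "deriv_seq [a] = []"
  "deriv_seq (a # b # x) = (a + b) # deriv_seq (b # x)"
  by (simp_all add: deriv_seq_def)

lemma length_deriv_seq [simp]: "length (deriv_seq x) = length x - 1"
  by (simp add: deriv_seq_def)

lemma deriv_seq_append2: "deriv_seq (x @ [a, b]) = deriv_seq (x @ [a]) @ [a + b]"
  by (induction x rule: induct_list012) simp_all

text \<open>Sums of neighbours do not depend on their order. This symmetry carries every fact about
  \<open>1 # replicate k 0\<close> over to its mirror image.\<close>

lemma deriv_seq_rev: "deriv_seq (rev x) = rev (deriv_seq x)"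
  by (induction x rule: induct_list012) (auto simp: deriv_seq_append2)

lemma deriv_seq_replicate [simp]: "deriv_seq (replicate k a) = replicate (k - 1) 0"
proof (induction k)
  case (Suc k)
  then show ?case by (cases k) simp_all
qed simp

lemma deriv_seq_eq_zeroD:
  "deriv_seq (a # x) = replicate k 0 \<Longrightarrow> x = replicate (length x) a"
proof (induction x arbitrary: a k)
  case (Cons b x)
  then obtain j where "k = Suc j" by (cases k) auto
  with Cons.prems have "a + b = 0" and "deriv_seq (b # x) = replicate j 0" by auto
  moreover from \<open>a + b = 0\<close> have "b = a" by (cases a; cases b) auto
  ultimately show ?case using Cons.IH[of b j] by simp
qed simp

lemma weight_simps [simp]:
  "weight [] = 0"
  "weight (a # x) = (if a = 1 then 1 else 0) + weight x"
  by (simp_all add: weight_def)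

lemma weight_append [simp]: "weight (x @ y) = weight x + weight y"
  by (induction x) simp_all

lemma weight_rev [simp]: "weight (rev x) = weight x"
  by (induction x) simp_all

lemma weight_replicate [simp]: "weight (replicate k a) = (if a = 1 then k else 0)"
  by (induction k) simp_all

lemma weight_eq_0D: "weight x = 0 \<Longrightarrow> x = replicate (length x) 0"
  by (induction x) (auto split: if_splits)

lemma triangle_weight_rec:
  "triangle_weight x = weight x + triangle_weight (deriv_seq x)"
proof (cases x)
  case (Cons a y)
  \<comment> \<open>Row \<open>Suc i\<close> of the triangle of \<open>x\<close> is row
    \<open>i\<close> of the triangle of \<open>deriv_seq x\<close>, so shifting the indices splits
    off the top row.\<close>
  have "[0..<length x] = 0 # map Suc [0..<length (deriv_seq x)]"
    using Cons by (simp add: map_Suc_upt upt_conv_Cons del: upt_Suc)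
  then show ?thesis
    by (simp add: triangle_weight_def steinhaus_triangle_def funpow_swap1 comp_def del: length_deriv_seq)
qed (simp add: triangle_weight_def steinhaus_triangle_def)

lemma triangle_weight_Nil [simp]: "triangle_weight [] = 0"
  by (simp add: triangle_weight_def steinhaus_triangle_def)

lemma triangle_weight_zeros [simp]: "triangle_weight (replicate k 0) = 0"
  by (induction k) (simp, subst triangle_weight_rec, simp del: replicate_Suc)

lemma triangle_weight_ones [simp]: "triangle_weight (replicate k 1) = k"
  by (simp add: triangle_weight_rec[of "replicate k 1"])

text \<open>The derivative only drops the last zero, so each of the \<open>Suc k\<close> rows
  contains exactly one 1.\<close>

lemma triangle_weight_one_zeros [simp]: "triangle_weight (1 # replicate k 0) = Suc k"
proof (induction k)
  case (Suc k)
  have "deriv_seq (1 # replicate (Suc k) 0) = 1 # deriv_seq (replicate (Suc k) 0)"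
    by (simp del: deriv_seq_replicate)
  then have "deriv_seq (1 # replicate (Suc k) 0) = 1 # replicate k 0"
    by (simp only: deriv_seq_replicate) simp
  with Suc show ?case
    by (subst triangle_weight_rec) simp
qed (simp add: triangle_weight_rec[of "[_]"])

lemma triangle_weight_rev [simp]: "triangle_weight (rev x) = triangle_weight x"
proof (induction "length x" arbitrary: x)
  case (Suc n)
  then have "triangle_weight (rev (deriv_seq x)) = triangle_weight (deriv_seq x)"
    by simp
  then show ?case
    by (simp add: triangle_weight_rec[of x] triangle_weight_rec[of "rev x"] deriv_seq_rev)
qed simp

lemma triangle_weight_zeros_one [simp]: "triangle_weight (replicate k 0 @ [1]) = Suc k"
  using triangle_weight_rev[of "1 # replicate k 0"] by simp

lemma deriv_seq_zero_cases:
  assumes "deriv_seq x = replicate k 0"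
  shows "x = replicate (length x) 0 \<or> x = replicate (length x) 1"
proof (cases x)
  case (Cons a y)
  then show ?thesis using deriv_seq_eq_zeroD[of a y k] assms by (cases a) auto
qed simp

lemma triangle_weight_ge_length:
  assumes "x \<noteq> replicate (length x) 0"
  shows "length x \<le> triangle_weight x"
  using assms
proof (induction "length x" arbitrary: x)
  case (Suc n)
  have *: "triangle_weight x = weight x + triangle_weight (deriv_seq x)"
    by (rule triangle_weight_rec)
  show ?case
  proof (cases "deriv_seq x = replicate n 0")
    case True
    with deriv_seq_zero_cases Suc.prems have "x = replicate (length x) 1" by blast
    then show ?thesis by (metis order_refl triangle_weight_ones)
  next
    case False
    moreover have "length (deriv_seq x) = n"
      using Suc.hyps(2) by simp
    ultimately have "n \<le> triangle_weight (deriv_seq x)"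
      using Suc.hyps(1)[of "deriv_seq x"] by simp
    moreover have "weight x \<noteq> 0" using weight_eq_0D Suc.prems by blast
    ultimately show ?thesis using * Suc.hyps(2) by linarith
  qed
qed simp

text \<open>After the first entry \<open>x\<close> is constant and differs from that entry, so the
  only rival is 0 followed by \<open>Suc k\<close> ones; its weight exceeds 1 because
  \<open>k \<ge> 1\<close>.\<close>

lemma deriv_seq_one_zerosD:
  assumes "deriv_seq x = 1 # replicate k 0" and "weight x = 1" and "k \<ge> 1"
  shows "x = 1 # replicate (Suc k) 0"
proof -
  from assms(1) obtain a b y where x: "x = a # b # y"
    by (cases x; cases "tl x") auto
  with assms(1) have "a + b = 1" and d: "deriv_seq (b # y) = replicate k 0" by auto
  have len: "length y = k"
    using arg_cong[OF assms(1), of length] x by simp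
  have y: "y = replicate k b" using deriv_seq_eq_zeroD[OF d] len by simp
  show ?thesis using \<open>a + b = 1\<close> assms(2,3) x y by (cases a; cases b) auto
qed

text \<open>Such an \<open>x\<close> alternates and has at least four entries, hence two ones among
  the first four. For \<open>k = 2\<close> the word 010 is a counterexample.\<close>

lemma deriv_seq_ones_weight:
  assumes "deriv_seq x = replicate k 1" and "k \<ge> 3"
  shows "weight x \<ge> 2"
proof -
  from assms(2) obtain j where k: "k = Suc (Suc (Suc j))"
    by (auto simp: le_iff_add)
  then have "length x = Suc (Suc (Suc (Suc j)))"
    using arg_cong[OF assms(1), of length] by simp
  then obtain a b c d y where "x = a # b # c # d # y" by (auto simp: length_Suc_conv)
  then show ?thesis using assms(1) k
    by (cases a; cases b; cases c; cases d) auto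
qed

text \<open>All sixteen words are evaluated. The induction cannot start at length 3, where 010 also
  has triangle weight 3.\<close>

lemma triangle_weight_eq_length_4:
  fixes x :: "bit list"
  assumes "length x = 4" and "triangle_weight x = 4"
  shows "x = [1,1,1,1] \<or> x = [1,0,0,0] \<or> x = [0,0,0,1]"
proof -
  from assms(1) obtain a b c d where "x = [a, b, c, d]"
    by (auto simp: length_Suc_conv numeral_eq_Suc)
  then show ?thesis using assms(2)
    by (cases a; cases b; cases c; cases d) (simp_all add: triangle_weight_rec[of "_ # _"])
qed

lemma triangle_weight_eq_length:
  assumes "length x = n" and "n \<ge> 4" and "triangle_weight x = n"
  shows "x = replicate n 1 \<or> x = 1 # replicate (n - 1) 0 \<or> x = replicate (n - 1) 0 @ [1]"
  using assms(2,1,3)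
proof (induction n arbitrary: x rule: dec_induct)
  case base
  then show ?case
    using triangle_weight_eq_length_4[of x] by (simp add: numeral_eq_Suc)
next
  case (step n)
  have tw: "weight x + triangle_weight (deriv_seq x) = Suc n"
    using step.prems triangle_weight_rec[of x] by simp
  have nz: "x \<noteq> replicate (length x) 0"
    using step.prems by (metis nat.distinct(1) triangle_weight_zeros)
  show ?case
  proof (cases "deriv_seq x = replicate n 0")
    case True
    with deriv_seq_zero_cases nz step.prems show ?thesis by metis
  next
    case False
    have len: "length (deriv_seq x) = n" using step.prems by simp
    with False have "n \<le> triangle_weight (deriv_seq x)"
      using triangle_weight_ge_length[of "deriv_seq x"] by simp
    moreover have "weight x \<noteq> 0" using weight_eq_0D nz by blast
    \<comment> \<open>The summands are at least 1 and \<open>n\<close> and add up to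
      \<open>Suc n\<close>, so both bounds are attained.\<close>
    ultimately have w1: "weight x = 1" and tn: "triangle_weight (deriv_seq x) = n"
      using tw by linarith+
    from step.hyps obtain k where k: "n = Suc k" "k \<ge> 3" by (cases n) auto
    from step.IH[OF len tn] k consider
        "deriv_seq x = replicate n 1" | "deriv_seq x = 1 # replicate k 0"
      | "deriv_seq x = replicate k 0 @ [1]" by auto
    then show ?thesis
    proof cases
      case 1
      \<comment> \<open>This case is contradictory: \<open>x\<close> would have weight at least
        2.\<close>
      with deriv_seq_ones_weight[of x n] w1 k show ?thesis by simp
    next
      case 2
      with deriv_seq_one_zerosD[of x k] w1 k show ?thesis by simp
    next
      case 3
      then have "deriv_seq (rev x) = 1 # replicate k 0" by (simp add: deriv_seq_rev)
      with deriv_seq_one_zerosD[of "rev x" k] w1 k have "rev x = 1 # replicate n 0" by simp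
      then have "x = rev (1 # replicate n 0)" by (metis rev_rev_ident)
      then show ?thesis by simp
    qed
  qed
qed

lemma periodic_prefix_singleton [simp]: "periodic_prefix [a] k = replicate k a"
  by (simp add: periodic_prefix_def map_replicate_const)

theorem theorem4p4:
  fixes n :: nat
  assumes "n \<ge> 4"
  shows "1 < card (triangle_weights n) \<and> w n 1 = n \<and>
    W n 1 = {periodic_prefix [1] n, [1] @ periodic_prefix [0] (n - 1), periodic_prefix [0] (n - 1) @ [1]}"
proof -
  let ?A = "triangle_weights n"
  have zero: "0 \<in> ?A"
    unfolding triangle_weights_def binary_seqs_def
    by (rule image_eqI[of _ _ "replicate n 0"]) simp_all
  have n: "n \<in> ?A"
    unfolding triangle_weights_def binary_seqs_def
    by (rule image_eqI[of _ _ "replicate n 1"]) simp_all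
  have gap: "n \<le> v" if "v \<in> ?A" "v \<noteq> 0" for v
  proof -
    from that(1) obtain x where "length x = n" "v = triangle_weight x"
      by (auto simp: triangle_weights_def binary_seqs_def)
    with that(2) triangle_weight_ge_length[of x] show ?thesis
      by (metis triangle_weight_zeros)
  qed
  have "card {0, n} \<le> card ?A"
    using zero n by (intro card_mono finite_triangle_weights) auto
  then have card: "1 < card ?A" using assms by simp
  \<comment> \<open>The entry at index 1 of the sorted list is found by removing the minimum twice:
    first 0, then \<open>n\<close>, the least nonzero value by \<open>gap\<close>.\<close>
  have "Min ?A = 0"
    using zero by (intro Min_eqI finite_triangle_weights) auto
  moreover have "Min (?A - {0}) = n"
    using n gap assms by (intro Min_eqI) (auto simp: finite_triangle_weights)
  moreover have "?A \<noteq> {}" "?A - {0} \<noteq> {}"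
    using zero n assms by auto
  ultimately have "sorted_list_of_set ?A = 0 # n # sorted_list_of_set (?A - {0} - {n})"
    using sorted_list_of_set_nonempty[of ?A] sorted_list_of_set_nonempty[of "?A - {0}"]
      finite_triangle_weights[of n] by simp
  then have w: "w n 1 = n" by (simp add: w_def)
  have "W n 1 = {x. length x = n \<and> triangle_weight x = n}"
    unfolding W_def w binary_seqs_def by simp
  also have "\<dots> = {replicate n 1, 1 # replicate (n - 1) 0, replicate (n - 1) 0 @ [1]}"
    \<comment> \<open>The classification gives one inclusion; the simp rules for the triangle
      weights of the three words give the other.\<close>
    using assms triangle_weight_eq_length[of _ n] by auto
  finally show ?thesis using card w by simp
qed

end
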